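(* The ADR repair scheduling problem is indexable: for every ADR in the pool and all subsidies $0\le\mu\le\zeta$, one has $\mathcal{B}_0(\mu)\subseteq\mathcal{B}_0(\zeta)$, where $\mathcal{B}_0(\mu)\subseteq[0,1]$ is the set of belief states in which the do-nothing action $\alpha_0$ is optimal in that ADR's subsidy-$\mu$ problem.
   Context: Single-ADR maintenance problem. An automated demand response device (ADR) is in a state in $\mathcal{S}=\{\gamma_0,\gamma_1\}$ ($\gamma_0$ non-operational, $\gamma_1$ operational). Before each demand response (DR) event $t=1,2,\dots$ the utility picks an action in $\mathcal{A}=\{\alpha_0,\alpha_1\}$ ($\alpha_0$: do nothing; $\alpha_1$: send a crew to reset the ADR). Parameters: $\lambda\ge 0$ (savings when the ADR works), $c\ge 0$ (repair cost), $p\in[0,1]$ (failure probability), $\beta\in(0,1)$ (discount factor). Transition probabilities $P_{ss'}(a)$: $P_{\gamma_0\gamma_0}(\alpha_0)=1$, $P_{\gamma_0\gamma_1}(\alpha_0)=0$, $P_{\gamma_1\gamma_0}(\alpha_0)=p$, $P_{\gamma_1\gamma_1}(\alpha_0)=1-p$; and $P_{s\gamma_0}(\alpha_1)=p$, $P_{s\gamma_1}(\alpha_1)=1-p$ for both $s\in\mathcal{S}$. Observations: during DR event $t$ a vector of meter readings $x_t\in\mathcal{X}\subseteq\mathbb{R}^m$ is observed; given $s_t=s$, $a_t=a$, it has probability density $Q_{sa}(\cdot)$ on $\mathcal{X}$ (nonnegative, measurable, integrating to 1). Belief-state MDP: the state is the belief $b\in[0,1]$, the conditional probability that the ADR is operational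 given the past actions and observations. The expected profits are $r_{\alpha_0}(b)=\lambda b$ and $r_{\alpha_1}(b)=\lambda-c$. Given belief $b$ and action $a$, the observation $x$ has density $W_{ab}(x)=Q_{\gamma_1a}(x)\,b+Q_{\gamma_0a}(x)(1-b)$, and the next belief is $$\Gamma_{ax}(b)=\frac{P_{\gamma_1\gamma_1}(a)Q_{\gamma_1a}(x)\,b+P_{\gamma_0\gamma_1}(a)Q_{\gamma_0a}(x)(1-b)}{W_{ab}(x)}$$ (points $x$ with $W_{ab}(x)=0$ carry no probability and are ignored). We write $\mathbb{E}_x[V(\Gamma_{ax}(b))]=\int_{\mathcal{X}}V(\Gamma_{ax}(b))W_{ab}(x)\,dx$. ADR repair scheduling problem. There are $D$ ADRs, each evolving as a single-ADR maintenance problem (belief state $b\in[0,1]$, actions $\alpha_0,\alpha_1$, expected profits $r_{\alpha_0}(b)=\lambda b$ and $r_{\alpha_1}(b)=\lambda-c$, observation density $W_{ab}$, next belief $\Gamma_{ax}(b)$), and $M$ maintenance crews, $M\ll D$; before each DR event the utility chooses at most $M$ ADRs to inspect and reset (action $\alpha_1$; "active"), the others receiving action $\alpha_0$ ("inactive"). It is a restless bandit problem in which each ADR is a bandit with state its belief $b$. Subsidy-$\mu$ problem ($\mu\ge 0$) of an ADR: the single-ADR maintenance problem in which the reward of $\alpha_0$ is increased by $\mu$, i.e. $r_{\alpha_0}(b,\mu)=\lambda b+\mu$, $r_{\alpha_1}(b,\mu)=\lambda-c$. Its optimal value function $V_\mu$ is the unique bounded solution of $$V_\mu(b)=\max_{a\in\mathcal{A}}\{r_a(b,\mu)+\beta\,\mathbb{E}_x[V_\mu(\Gamma_{ax}(b))]\},\quad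 b\in[0,1],$$ and an action is optimal at $b$ if it attains this maximum. The restless bandit problem is called indexable if, for each bandit, $\mathcal{B}_0(\mu)\subseteq\mathcal{B}_0(\zeta)$ whenever $0\le\mu\le\zeta$. *)

theory Defs
  imports "HOL-Analysis.Analysis"
begin

section \<open>Single-ADR maintenance problem\<close>

datatype adr_state = Non_operational | Operational

datatype adr_action = Do_nothing | Reset

record ('m::finite) adr =
  savings :: real
  repair_cost :: real
  fail_prob :: real
  obs_space :: "(real ^ 'm) set"
  obs_density :: "adr_state \<Rightarrow> adr_action \<Rightarrow> real ^ 'm \<Rightarrow> real"

definition valid_adr :: "('m::finite) adr \<Rightarrow> bool" where
  "valid_adr A \<longleftrightarrow>
     0 \<le> savings A \<and> 0 \<le> repair_cost A \<and> 0 \<le> fail_prob A \<and> fail_prob A \<le> 1 \<and>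
     obs_space A \<in> sets lebesgue \<and>
     (\<forall>s a. obs_density A s a \<in> borel_measurable (lebesgue_on (obs_space A)) \<and>
            (\<forall>x\<in>obs_space A. 0 \<le> obs_density A s a x) \<and>
            has_bochner_integral (lebesgue_on (obs_space A)) (obs_density A s a) 1)"

fun trans_prob :: "('m::finite) adr \<Rightarrow> adr_action \<Rightarrow> adr_state \<Rightarrow> adr_state \<Rightarrow> real" where
  "trans_prob A Do_nothing Non_operational Non_operational = 1"
| "trans_prob A Do_nothing Non_operational Operational = 0"
| "trans_prob A Do_nothing Operational Non_operational = fail_prob A"
| "trans_prob A Do_nothing Operational Operational = 1 - fail_prob A"
| "trans_prob A Reset _ Non_operational = fail_prob A"
| "trans_prob A Reset _ Operational = 1 - fail_prob A"

text \<open>In the following, \<open>b\<close> is the belief, i.e. the conditional probability of \<open>Operational\<close>.\<close>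

definition belief_obs_density ::
    "('m::finite) adr \<Rightarrow> adr_action \<Rightarrow> real \<Rightarrow> real ^ 'm \<Rightarrow> real" where
  "belief_obs_density A a b x =
     obs_density A Operational a x * b + obs_density A Non_operational a x * (1 - b)"

text \<open>Where the observation density vanishes, division by zero makes \<open>next_belief\<close> zero; this
  value is irrelevant, since in \<open>expected_next\<close> it is weighted by that density.\<close>

definition next_belief ::
    "('m::finite) adr \<Rightarrow> adr_action \<Rightarrow> real ^ 'm \<Rightarrow> real \<Rightarrow> real" where
  "next_belief A a x b =
     (trans_prob A a Operational Operational * obs_density A Operational a x * b +
      trans_prob A a Non_operational Operational * obs_density A Non_operational a x * (1 - b))
     / belief_obs_density A a b x"

definition expected_next ::
    "('m::finite) adr \<Rightarrow> (real \<Rightarrow> real) \<Rightarrow> adr_action \<Rightarrow> real \<Rightarrow> real" where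
  "expected_next A V a b =
     (LINT x|lebesgue_on (obs_space A). V (next_belief A a x b) * belief_obs_density A a b x)"

section \<open>The problem with a subsidy for doing nothing\<close>

fun subsidy_reward :: "('m::finite) adr \<Rightarrow> real \<Rightarrow> adr_action \<Rightarrow> real \<Rightarrow> real" where
  "subsidy_reward A \<mu> Do_nothing b = savings A * b + \<mu>"
| "subsidy_reward A \<mu> Reset b = savings A - repair_cost A"

definition action_value ::
    "real \<Rightarrow> ('m::finite) adr \<Rightarrow> real \<Rightarrow> (real \<Rightarrow> real) \<Rightarrow> adr_action \<Rightarrow> real \<Rightarrow> real" where
  "action_value \<beta> A \<mu> V a b = subsidy_reward A \<mu> a b + \<beta> * expected_next A V a b"

text \<open>Integrability is required explicitly because the Bochner integral of a non-integrable
  function is zero by convention; without it a non-measurable function could satisfy the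
  Bellman equation spuriously.\<close>

definition bounded_bellman_solution ::
    "real \<Rightarrow> ('m::finite) adr \<Rightarrow> real \<Rightarrow> (real \<Rightarrow> real) \<Rightarrow> bool" where
  "bounded_bellman_solution \<beta> A \<mu> V \<longleftrightarrow>
     bounded (V ` {0..1}) \<and>
     (\<forall>a. \<forall>b\<in>{0..1}. integrable (lebesgue_on (obs_space A))
        (\<lambda>x. V (next_belief A a x b) * belief_obs_density A a b x)) \<and>
     (\<forall>b\<in>{0..1}. V b = (MAX a\<in>{Do_nothing, Reset}. action_value \<beta> A \<mu> V a b))"

text \<open>Value functions live on \<open>[0,1]\<close>; \<open>extensional\<close> fixes the irrelevant values elsewhere, so
  that the solution is unique as a function on all of \<open>\<real>\<close>.\<close>

definition subsidy_value :: "real \<Rightarrow> ('m::finite) adr \<Rightarrow> real \<Rightarrow> real \<Rightarrow> real" where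
  "subsidy_value \<beta> A \<mu> =
     (THE V. V \<in> extensional {0..1} \<and> bounded_bellman_solution \<beta> A \<mu> V)"

definition optimal_action ::
    "real \<Rightarrow> ('m::finite) adr \<Rightarrow> real \<Rightarrow> adr_action \<Rightarrow> real \<Rightarrow> bool" where
  "optimal_action \<beta> A \<mu> a b \<longleftrightarrow>
     action_value \<beta> A \<mu> (subsidy_value \<beta> A \<mu>) a b =
     (MAX a'\<in>{Do_nothing, Reset}. action_value \<beta> A \<mu> (subsidy_value \<beta> A \<mu>) a' b)"

definition passive_set :: "real \<Rightarrow> ('m::finite) adr \<Rightarrow> real \<Rightarrow> real set" where
  "passive_set \<beta> A \<mu> = {b \<in> {0..1}. optimal_action \<beta> A \<mu> Do_nothing b}"

section \<open>The repair scheduling problem\<close>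

text \<open>The ADRs are \<open>adr_of P i\<close> for \<open>i < n_adrs P\<close>. At most \<open>n_crews P\<close> of them may be reset
  before each event. This coupling constraint does not enter indexability, which is a property
  of the individual bandits.\<close>

record ('m::finite) repair_problem =
  n_adrs :: nat
  n_crews :: nat
  discount :: real
  adr_of :: "nat \<Rightarrow> 'm adr"

definition valid_repair_problem :: "('m::finite) repair_problem \<Rightarrow> bool" where
  "valid_repair_problem P \<longleftrightarrow>
     n_crews P < n_adrs P \<and> 0 < discount P \<and> discount P < 1 \<and>
     (\<forall>i<n_adrs P. valid_adr (adr_of P i))"

definition indexable :: "('m::finite) repair_problem \<Rightarrow> bool" where
  "indexable P \<longleftrightarrow>
     (\<forall>i<n_adrs P. \<forall>\<mu> \<zeta>. 0 \<le> \<mu> \<and> \<mu> \<le> \<zeta> \<longrightarrow>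
        passive_set (discount P) (adr_of P i) \<mu> \<subseteq> passive_set (discount P) (adr_of P i) \<zeta>)"

end

theory Submission
  imports Defs
begin

text \<open>
  Resetting leads to the belief \<open>1 - p\<close> whatever the observation, so its value \<open>K \<mu>\<close> does not
  depend on the current belief. Let \<open>0 \<le> \<mu> \<le> \<zeta>\<close>, \<open>\<delta> = \<zeta> - \<mu>\<close> and
  \<open>K' = K \<zeta> - K \<mu> = \<beta> (V \<zeta> (1 - p) - V \<mu> (1 - p))\<close>. Comparing Bellman equations yields
  \<open>V \<zeta> - V \<mu> \<le> \<delta> / (1 - \<beta>)\<close>, hence \<open>(1 - \<beta>) K' \<le> \<beta> \<delta>\<close>. If \<open>m\<close> is the infimum of \<open>V \<zeta> - V \<mu>\<close>,
  the Bellman equations give \<open>m \<ge> min (\<delta> + \<beta> m) K'\<close>, and therefore \<open>m \<ge> K'\<close>. Consequently the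
  advantage of doing nothing over resetting grows by at least
  \<open>\<delta> + \<beta> K' - K' \<ge> \<delta> - \<beta> \<delta> \<ge> 0\<close> when \<open>\<mu>\<close> is raised to \<open>\<zeta>\<close>; this needs neither convexity of the
  value function nor a threshold structure of the optimal policy. Existence of the value function
  is Banach's fixed point theorem for bounded continuous functions.
\<close>

section \<open>Belief dynamics\<close>

lemma trans_prob_Operational_bounds:
  assumes "valid_adr A"
  shows "0 \<le> trans_prob A a s Operational" "trans_prob A a s Operational \<le> 1"
  using assms by (cases a; cases s; simp add: valid_adr_def)+

lemma obs_density_nonneg:
  assumes "valid_adr A" "x \<in> obs_space A"
  shows "0 \<le> obs_density A s a x"
  using assms by (auto simp: valid_adr_def)

lemma obs_density_measurable:
  assumes "valid_adr A"
  shows "obs_density A s a \<in> borel_measurable (lebesgue_on (obs_space A))"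
  using assms by (auto simp: valid_adr_def)

lemma obs_density_integrable:
  assumes "valid_adr A"
  shows "integrable (lebesgue_on (obs_space A)) (obs_density A s a)"
  using assms by (auto simp: valid_adr_def has_bochner_integral_iff)

lemma belief_obs_density_nonneg:
  assumes "valid_adr A" "b \<in> {0..1}" "x \<in> obs_space A"
  shows "0 \<le> belief_obs_density A a b x"
  using assms by (simp add: belief_obs_density_def obs_density_nonneg)

lemma has_bochner_integral_belief_obs_density:
  assumes "valid_adr A"
  shows "has_bochner_integral (lebesgue_on (obs_space A)) (belief_obs_density A a b) 1"
proof -
  have "has_bochner_integral (lebesgue_on (obs_space A))
      (\<lambda>x. obs_density A Operational a x * b + obs_density A Non_operational a x * (1 - b))
      (1 * b + 1 * (1 - b))"
    using assms unfolding valid_adr_def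
    by (intro has_bochner_integral_add has_bochner_integral_mult_left) auto
  then show ?thesis
    by (simp add: belief_obs_density_def[abs_def])
qed

lemma integrable_belief_obs_density:
  assumes "valid_adr A"
  shows "integrable (lebesgue_on (obs_space A)) (belief_obs_density A a b)"
    and "(LINT x|lebesgue_on (obs_space A). belief_obs_density A a b x) = 1"
  using has_bochner_integral_belief_obs_density[OF assms, of a b]
  by (auto simp: has_bochner_integral_iff)

text \<open>The right side is free of \<open>b\<close>, which makes it usable as the majorant in the
  dominated convergence argument for continuity in the belief.\<close>

lemma belief_obs_density_le:
  assumes "valid_adr A" "b \<in> {0..1}" "x \<in> obs_space A"
  shows "belief_obs_density A a b x \<le> obs_density A Operational a x + obs_density A Non_operational a x"
  unfolding belief_obs_density_def using assms
  by (intro add_mono mult_left_le) (auto simp: obs_density_nonneg)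

text \<open>Transition probabilities lie in [0,1], so the numerator is termwise at most the
  denominator. If the density vanishes, division by zero gives 0, which is still a belief.\<close>

lemma next_belief_in_unit:
  assumes "valid_adr A" "b \<in> {0..1}" "x \<in> obs_space A"
  shows "next_belief A a x b \<in> {0..1}"
proof -
  let ?q = "\<lambda>s. obs_density A s a x" and ?t = "\<lambda>s. trans_prob A a s Operational"
  have q: "0 \<le> ?q s" for s
    using assms obs_density_nonneg by blast
  have t: "0 \<le> ?t s" "?t s \<le> 1" for s
    using assms trans_prob_Operational_bounds by blast+
  have "0 \<le> ?t Operational * (?q Operational * b)"
    "?t Operational * (?q Operational * b) \<le> ?q Operational * b"
    "0 \<le> ?t Non_operational * (?q Non_operational * (1 - b))"
    "?t Non_operational * (?q Non_operational * (1 - b)) \<le> ?q Non_operational * (1 - b)"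
    using q t assms by (auto intro!: mult_left_le_one_le mult_nonneg_nonneg)
  then show ?thesis
    unfolding next_belief_def belief_obs_density_def
    by (auto simp: mult.assoc intro!: divide_nonneg_nonneg divide_le_eq_1[THEN iffD2])
qed

text \<open>After \<open>Reset\<close> both states lead to \<open>Operational\<close> with the same
  probability, which factors out of the numerator; the remaining density cancels.\<close>

lemma next_belief_Reset:
  assumes "belief_obs_density A Reset b x \<noteq> 0"
  shows "next_belief A Reset x b = 1 - fail_prob A"
proof -
  have "next_belief A Reset x b =
      (1 - fail_prob A) * belief_obs_density A Reset b x / belief_obs_density A Reset b x"
    by (simp add: next_belief_def belief_obs_density_def algebra_simps)
  then show ?thesis
    using assms by simp
qed

lemma expected_next_Reset:
  assumes "valid_adr A"
  shows "expected_next A V Reset b = V (1 - fail_prob A)"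
proof -
  \<comment> \<open>Where the density is zero both sides vanish, so the identity holds at every
    point and \<open>V\<close> may be arbitrary.\<close>
  have *: "V (next_belief A Reset x b) * belief_obs_density A Reset b x =
      V (1 - fail_prob A) * belief_obs_density A Reset b x" for x
    by (cases "belief_obs_density A Reset b x = 0") (simp_all add: next_belief_Reset)
  show ?thesis
    unfolding expected_next_def * by (simp add: integrable_belief_obs_density[OF assms])
qed

text \<open>The density has total mass 1, so a constant shift passes through the expectation
  unchanged. Every later comparison of value functions rests on this.\<close>

lemma expected_next_le_add:
  assumes "valid_adr A" "b \<in> {0..1}"
    and "integrable (lebesgue_on (obs_space A))
      (\<lambda>x. V (next_belief A a x b) * belief_obs_density A a b x)"
    and "integrable (lebesgue_on (obs_space A))
      (\<lambda>x. U (next_belief A a x b) * belief_obs_density A a b x)"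
    and le: "\<And>y. y \<in> {0..1} \<Longrightarrow> V y \<le> U y + m"
  shows "expected_next A V a b \<le> expected_next A U a b + m"
proof -
  note int = integrable_belief_obs_density[OF assms(1), of a b]
  have "expected_next A V a b \<le> (LINT x|lebesgue_on (obs_space A).
      U (next_belief A a x b) * belief_obs_density A a b x + m * belief_obs_density A a b x)"
    unfolding expected_next_def
  proof (rule integral_mono)
    fix x assume "x \<in> space (lebesgue_on (obs_space A))"
    then have x: "x \<in> obs_space A"
      by (simp add: space_restrict_space)
    show "V (next_belief A a x b) * belief_obs_density A a b x \<le>
        U (next_belief A a x b) * belief_obs_density A a b x + m * belief_obs_density A a b x"
      unfolding distrib_right[symmetric]
      by (intro mult_right_mono le next_belief_in_unit belief_obs_density_nonneg assms x)
  qed (use assms int in auto)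
  also have "\<dots> = expected_next A U a b + m"
    using assms int by (simp add: expected_next_def)
  finally show ?thesis .
qed

text \<open>Borel measurability of \<open>f\<close> makes its composition with the Lebesgue
  measurable posterior measurable; a multiple of the density dominates.\<close>

lemma bounded_integrable_next_belief:
  fixes f :: "real \<Rightarrow> real"
  assumes "valid_adr A" "b \<in> {0..1}" and "f \<in> borel_measurable borel" and M: "\<And>y. \<bar>f y\<bar> \<le> M"
  shows "integrable (lebesgue_on (obs_space A))
      (\<lambda>x. f (next_belief A a x b) * belief_obs_density A a b x)"
proof (rule Bochner_Integration.integrable_bound)
  show "integrable (lebesgue_on (obs_space A)) (\<lambda>x. M * belief_obs_density A a b x)"
    using integrable_belief_obs_density[OF assms(1)] by simp
  note [measurable] = assms(3) obs_density_measurable[OF assms(1)]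
  show "(\<lambda>x. f (next_belief A a x b) * belief_obs_density A a b x)
      \<in> borel_measurable (lebesgue_on (obs_space A))"
    unfolding next_belief_def belief_obs_density_def by measurable
  show "AE x in lebesgue_on (obs_space A).
      norm (f (next_belief A a x b) * belief_obs_density A a b x) \<le>
      norm (M * belief_obs_density A a b x)"
  proof (rule AE_I2)
    fix x
    have "\<bar>f (next_belief A a x b)\<bar> \<le> \<bar>M\<bar>"
      using M[of "next_belief A a x b"] by linarith
    then show "norm (f (next_belief A a x b) * belief_obs_density A a b x) \<le>
        norm (M * belief_obs_density A a b x)"
      by (simp add: abs_mult mult_right_mono)
  qed
qed

section \<open>Bellman equations\<close>

lemma bellman_solution_eq:
  assumes "bounded_bellman_solution \<beta> A \<mu> V" "b \<in> {0..1}"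
  shows "V b = max (action_value \<beta> A \<mu> V Do_nothing b) (action_value \<beta> A \<mu> V Reset b)"
  using assms by (simp add: bounded_bellman_solution_def)

lemma action_value_cong:
  assumes "valid_adr A" "b \<in> {0..1}" "\<And>y. y \<in> {0..1} \<Longrightarrow> V y = U y"
  shows "action_value \<beta> A \<mu> V a b = action_value \<beta> A \<mu> U a b"
proof -
  have "expected_next A V a b = expected_next A U a b"
    unfolding expected_next_def
    by (rule Bochner_Integration.integral_cong)
      (auto simp: space_restrict_space assms(3)[OF next_belief_in_unit[OF assms(1,2)]])
  then show ?thesis
    by (simp add: action_value_def)
qed

text \<open>Beliefs never leave [0,1], so a solution may be replaced by its restriction, as the
  extensionality in \<open>subsidy_value\<close> demands.\<close>

lemma bounded_bellman_solution_cong: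
  assumes "valid_adr A" "\<And>y. y \<in> {0..1} \<Longrightarrow> V y = U y" "bounded_bellman_solution \<beta> A \<mu> V"
  shows "bounded_bellman_solution \<beta> A \<mu> U"
proof -
  have "U ` {0..1} = V ` {0..1}"
    using assms(2) by (intro image_cong) auto
  then have "bounded (U ` {0..1})"
    using assms(3) unfolding bounded_bellman_solution_def by metis
  moreover have "integrable (lebesgue_on (obs_space A))
      (\<lambda>x. V (next_belief A a x b) * belief_obs_density A a b x) \<longleftrightarrow>
    integrable (lebesgue_on (obs_space A))
      (\<lambda>x. U (next_belief A a x b) * belief_obs_density A a b x)" if "b \<in> {0..1}" for a b
    by (rule Bochner_Integration.integrable_cong[OF refl])
      (simp add: space_restrict_space assms(2)[OF next_belief_in_unit[OF assms(1) that]])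
  ultimately show ?thesis
    using assms(2,3) action_value_cong[of A _ V U, OF assms(1) _ assms(2)]
    unfolding bounded_bellman_solution_def by simp
qed

text \<open>One step of lookahead discounts a gap \<open>m\<close> to \<open>\<beta> * m\<close>;
  the difference of subsidies enters only when doing nothing.\<close>

lemma bellman_solution_action_value_le:
  assumes "valid_adr A" "0 \<le> \<beta>" "b \<in> {0..1}"
    and "bounded_bellman_solution \<beta> A \<mu> V" "bounded_bellman_solution \<beta> A \<zeta> U"
    and "\<And>y. y \<in> {0..1} \<Longrightarrow> V y \<le> U y + m"
  shows "action_value \<beta> A \<mu> V Do_nothing b \<le> action_value \<beta> A \<zeta> U Do_nothing b + (\<mu> - \<zeta>) + \<beta> * m"
    and "action_value \<beta> A \<mu> V Reset b \<le> action_value \<beta> A \<zeta> U Reset b + \<beta> * m"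
proof -
  have "\<beta> * expected_next A V a b \<le> \<beta> * expected_next A U a b + \<beta> * m" for a
    unfolding distrib_left[symmetric]
    using assms by (intro mult_left_mono expected_next_le_add) (auto simp: bounded_bellman_solution_def)
  from this[of Do_nothing] this[of Reset] show
    "action_value \<beta> A \<mu> V Do_nothing b \<le> action_value \<beta> A \<zeta> U Do_nothing b + (\<mu> - \<zeta>) + \<beta> * m"
    "action_value \<beta> A \<mu> V Reset b \<le> action_value \<beta> A \<zeta> U Reset b + \<beta> * m"
    by (auto simp: action_value_def)
qed

text \<open>If the supremum exceeded \<open>L\<close>, then \<open>step\<close> applied to it would
  shrink its distance to \<open>L\<close> by the factor \<open>\<beta> < 1\<close>, a contradiction.
  The supremum need not be attained.\<close>

lemma le_by_contraction:
  fixes f :: "'a \<Rightarrow> real"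
  assumes "bdd_above (f ` S)" "\<beta> < 1" "x \<in> S"
    and step: "\<And>m y. L \<le> m \<Longrightarrow> (\<And>z. z \<in> S \<Longrightarrow> f z \<le> m) \<Longrightarrow> y \<in> S \<Longrightarrow> f y \<le> L + \<beta> * (m - L)"
  shows "f x \<le> L"
proof (rule ccontr)
  let ?s = "SUP y\<in>S. f y"
  have ub: "f y \<le> ?s" if "y \<in> S" for y
    using that assms(1) by (rule cSUP_upper)
  assume "\<not> f x \<le> L"
  then have "L < ?s"
    using ub[OF assms(3)] by linarith
  then have "?s \<le> L + \<beta> * (?s - L)"
    using assms(3) ub by (intro cSUP_least step) auto
  then have "(1 - \<beta>) * (?s - L) \<le> 0"
    by (simp add: algebra_simps)
  with \<open>L < ?s\<close> \<open>\<beta> < 1\<close> show False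
    by (simp add: mult_le_0_iff)
qed

lemma bdd_above_diff_bellman_solutions:
  assumes "bounded_bellman_solution \<beta> A \<mu> V" "bounded_bellman_solution \<beta> A \<zeta> U"
  shows "bdd_above ((\<lambda>b. V b - U b) ` {0..1})"
  using assms unfolding bounded_bellman_solution_def
  by (intro bounded_imp_bdd_above bounded_minus_comp) auto

text \<open>An extra subsidy of at most \<open>k\<close> per event is worth at most
  \<open>k / (1 - \<beta>)\<close>, the fixed point of \<open>m \<mapsto> k + \<beta> * m\<close>.
  Equal subsidies give the bound 0, hence uniqueness.\<close>

lemma bellman_solution_diff_le:
  assumes A: "valid_adr A" and \<beta>: "0 \<le> \<beta>" "\<beta> < 1" and b: "b \<in> {0..1}"
    and V: "bounded_bellman_solution \<beta> A \<mu> V" and U: "bounded_bellman_solution \<beta> A \<zeta> U"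
  shows "V b - U b \<le> max 0 (\<mu> - \<zeta>) / (1 - \<beta>)"
proof (rule le_by_contraction[where f = "\<lambda>b. V b - U b", OF _ \<beta>(2) b])
  let ?k = "max 0 (\<mu> - \<zeta>)"
  fix m y :: real
  assume "\<And>z. z \<in> {0..1} \<Longrightarrow> V z - U z \<le> m" and y: "y \<in> {0..1}"
  then have "V z \<le> U z + m" if "z \<in> {0..1}" for z
    using that by (simp add: algebra_simps)
  from bellman_solution_action_value_le[OF A \<beta>(1) y V U this]
  have "V y - U y \<le> ?k + \<beta> * m"
    using bellman_solution_eq[OF V y] bellman_solution_eq[OF U y] by linarith
  also have "?k = (1 - \<beta>) * (?k / (1 - \<beta>))"
    using \<beta>(2) by simp
  also have "\<dots> + \<beta> * m = ?k / (1 - \<beta>) + \<beta> * (m - ?k / (1 - \<beta>))"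
    by (simp only: left_diff_distrib right_diff_distrib)
  finally show "V y - U y \<le> ?k / (1 - \<beta>) + \<beta> * (m - ?k / (1 - \<beta>))" .
qed (rule bdd_above_diff_bellman_solutions[OF V U])

lemma bellman_solution_unique:
  assumes "valid_adr A" "0 \<le> \<beta>" "\<beta> < 1" "b \<in> {0..1}"
    and "bounded_bellman_solution \<beta> A \<mu> V" "bounded_bellman_solution \<beta> A \<mu> U"
  shows "V b = U b"
  using bellman_solution_diff_le[OF assms] bellman_solution_diff_le[OF assms(1-4,6,5)] by simp

section \<open>Existence of the value function\<close>

text \<open>The posterior may jump where the density vanishes, but there the bounded factor is
  multiplied by something tending to 0. Elsewhere the quotient is continuous.\<close>

lemma continuous_on_mult_next_belief:
  fixes f :: "real \<Rightarrow> real"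
  assumes A: "valid_adr A" and x: "x \<in> obs_space A"
    and f: "continuous_on UNIV f" and M: "\<And>y. \<bar>f y\<bar> \<le> M"
  shows "continuous_on {0..1} (\<lambda>b. f (next_belief A a x b) * belief_obs_density A a b x)"
  unfolding continuous_on_def
proof
  fix b :: real assume "b \<in> {0..1}"
  have W: "((\<lambda>b. belief_obs_density A a b x) \<longlongrightarrow> belief_obs_density A a b x) (at b within {0..1})"
    unfolding belief_obs_density_def by (intro tendsto_intros)
  show "((\<lambda>b. f (next_belief A a x b) * belief_obs_density A a b x) \<longlongrightarrow>
      f (next_belief A a x b) * belief_obs_density A a b x) (at b within {0..1})"
  proof (cases "belief_obs_density A a b x = 0")
    case True
    have "((\<lambda>b. f (next_belief A a x b) * belief_obs_density A a b x) \<longlongrightarrow> 0) (at b within {0..1})"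
    proof (rule Lim_null_comparison)
      show "((\<lambda>b. M * \<bar>belief_obs_density A a b x\<bar>) \<longlongrightarrow> 0) (at b within {0..1})"
        using tendsto_mult_left[OF tendsto_rabs[OF W], of M] True by simp
      show "\<forall>\<^sub>F b in at b within {0..1}.
          norm (f (next_belief A a x b) * belief_obs_density A a b x) \<le>
          M * \<bar>belief_obs_density A a b x\<bar>"
        by (intro always_eventually allI) (simp add: abs_mult M mult_right_mono)
    qed
    with True show ?thesis
      by simp
  next
    case False
    have "((\<lambda>b. next_belief A a x b) \<longlongrightarrow> next_belief A a x b) (at b within {0..1})"
      unfolding next_belief_def by (intro tendsto_intros W False)
    moreover have "isCont f (next_belief A a x b)"
      using f by (simp add: continuous_on_eq_continuous_at)
    ultimately show ?thesis
      by (intro tendsto_mult W) (rule isCont_tendsto_compose)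
  qed
qed

lemma continuous_on_expected_next:
  fixes f :: "real \<Rightarrow> real"
  assumes A: "valid_adr A" and f: "continuous_on UNIV f" and M: "\<And>y. \<bar>f y\<bar> \<le> M"
  shows "continuous_on {0..1} (expected_next A f a)"
  unfolding continuous_on_sequentially
proof (intro ballI allI impI, elim conjE)
  let ?g = "\<lambda>b x. f (next_belief A a x b) * belief_obs_density A a b x"
  fix X :: "nat \<Rightarrow> real" and b assume b: "b \<in> {0..1}" and X: "\<forall>n. X n \<in> {0..1}" "X \<longlonglongrightarrow> b"
  have f': "f \<in> borel_measurable borel"
    using f by (rule borel_measurable_continuous_onI)
  have "(\<lambda>n. LINT x|lebesgue_on (obs_space A). ?g (X n) x) \<longlonglongrightarrow>
      (LINT x|lebesgue_on (obs_space A). ?g b x)"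
  proof (rule integral_dominated_convergence)
    show "integrable (lebesgue_on (obs_space A))
        (\<lambda>x. M * (obs_density A Operational a x + obs_density A Non_operational a x))"
      using obs_density_integrable[OF A] by simp
    show "?g b \<in> borel_measurable (lebesgue_on (obs_space A))"
      by (rule borel_measurable_integrable[OF bounded_integrable_next_belief[OF A b f' M]])
    show "?g (X n) \<in> borel_measurable (lebesgue_on (obs_space A))" for n
      using X(1) by (intro borel_measurable_integrable bounded_integrable_next_belief[OF A _ f' M]) auto
    show "AE x in lebesgue_on (obs_space A). (\<lambda>n. ?g (X n) x) \<longlonglongrightarrow> ?g b x"
    proof (rule AE_I2)
      fix x assume "x \<in> space (lebesgue_on (obs_space A))"
      then have "x \<in> obs_space A"
        by (simp add: space_restrict_space)
      from continuous_on_mult_next_belief[OF A this f M, of a] b X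
      show "(\<lambda>n. ?g (X n) x) \<longlonglongrightarrow> ?g b x"
        unfolding continuous_on_sequentially comp_def by blast
    qed
    show "AE x in lebesgue_on (obs_space A). norm (?g (X n) x) \<le>
        M * (obs_density A Operational a x + obs_density A Non_operational a x)" for n
    proof (rule AE_I2)
      fix x assume "x \<in> space (lebesgue_on (obs_space A))"
      then have x: "x \<in> obs_space A"
        by (simp add: space_restrict_space)
      have Xn: "X n \<in> {0..1}"
        using X(1) by blast
      have "0 \<le> M"
        using M[of 0] by linarith
      then have "\<bar>f (next_belief A a x (X n))\<bar> * \<bar>belief_obs_density A a (X n) x\<bar> \<le>
          M * (obs_density A Operational a x + obs_density A Non_operational a x)"
        using belief_obs_density_le[OF A Xn x, of a] belief_obs_density_nonneg[OF A Xn x, of a]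
        by (intro mult_mono M) auto
      then show "norm (?g (X n) x) \<le>
          M * (obs_density A Operational a x + obs_density A Non_operational a x)"
        by (simp add: abs_mult)
    qed
  qed
  then show "(expected_next A f a \<circ> X) \<longlonglongrightarrow> expected_next A f a b"
    by (simp add: expected_next_def comp_def)
qed

lemma ex_bellman_solution:
  assumes A: "valid_adr A" and \<beta>: "0 \<le> \<beta>" "\<beta> < 1"
  shows "\<exists>V. bounded_bellman_solution \<beta> A \<mu> V"
proof -
  \<comment> \<open>Clamping to [0,1] lets the Bellman operator \<open>T\<close> act on bounded
    continuous functions on the whole line, a complete metric space available as a type.\<close>
  define c :: "real \<Rightarrow> real" where "c = (\<lambda>b. max 0 (min 1 b))"
  define T where "T = (\<lambda>f b. max (action_value \<beta> A \<mu> f Do_nothing (c b))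
    (action_value \<beta> A \<mu> f Reset (c b)))"
  have c: "c b \<in> {0..1}" for b
    by (auto simp: c_def)
  have c_id: "c b = b" if "b \<in> {0..1}" for b
    using that by (auto simp: c_def)
  have c_cont: "continuous_on UNIV c"
    unfolding c_def by (intro continuous_intros)
  note cont = continuous_on_apply_bcontfun
  have bound: "\<bar>apply_bcontfun f y\<bar> \<le> norm f" for f :: "real \<Rightarrow>\<^sub>C real" and y
    using norm_bounded[of f y] by simp
  have int: "integrable (lebesgue_on (obs_space A))
      (\<lambda>x. apply_bcontfun f (next_belief A a x b) * belief_obs_density A a b x)"
    if "b \<in> {0..1}" for f a b
    by (rule bounded_integrable_next_belief[OF A that _ bound])
      (intro borel_measurable_continuous_onI cont)
  have T_bcontfun: "T (apply_bcontfun f) \<in> bcontfun" for f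
  proof -
    have r: "continuous_on {0..1} (subsidy_reward A \<mu> a)" for a
      by (cases a) (auto intro!: continuous_intros)
    have e: "continuous_on {0..1} (expected_next A (apply_bcontfun f) a)" for a
      by (rule continuous_on_expected_next[OF A cont bound])
    have q: "continuous_on {0..1} (action_value \<beta> A \<mu> (apply_bcontfun f) a)" for a
      unfolding action_value_def[abs_def] by (intro continuous_intros r e)
    let ?h = "\<lambda>b. max (action_value \<beta> A \<mu> (apply_bcontfun f) Do_nothing b)
      (action_value \<beta> A \<mu> (apply_bcontfun f) Reset b)"
    have h: "continuous_on {0..1} ?h"
      by (intro continuous_intros q)
    have T_h: "T (apply_bcontfun f) = ?h \<circ> c"
      by (simp add: T_def comp_def)
    have "continuous_on UNIV (?h \<circ> c)"
      by (rule continuous_on_compose[OF c_cont]) (rule continuous_on_subset[OF h], use c in auto)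
    moreover have "bounded (range (?h \<circ> c))"
      by (rule bounded_subset[OF compact_imp_bounded[OF compact_continuous_image[OF h compact_Icc]]])
        (use c in \<open>auto simp: image_comp[symmetric]\<close>)
    ultimately show ?thesis
      unfolding T_h bcontfun_def by blast
  qed
  have contract: "dist (Bcontfun (T (apply_bcontfun f))) (Bcontfun (T (apply_bcontfun g))) \<le>
      \<beta> * dist f g" for f g
  proof (rule dist_bound)
    fix b
    \<comment> \<open>Stated for arbitrary \<open>f\<close> and \<open>g\<close>, so that exchanging
      them turns the one-sided estimate into a bound on the absolute difference.\<close>
    have q: "action_value \<beta> A \<mu> (apply_bcontfun f) a (c b) \<le>
        action_value \<beta> A \<mu> (apply_bcontfun g) a (c b) + \<beta> * dist f g" for f g a
    proof -
      have "apply_bcontfun f y \<le> apply_bcontfun g y + dist f g" for y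
        using dist_bounded[of f y g] by (simp add: dist_real_def)
      then have "expected_next A f a (c b) \<le> expected_next A g a (c b) + dist f g"
        by (intro expected_next_le_add A c int)
      then have "\<beta> * expected_next A f a (c b) \<le> \<beta> * (expected_next A g a (c b) + dist f g)"
        using \<beta>(1) by (rule mult_left_mono)
      then show ?thesis
        by (simp add: action_value_def distrib_left)
    qed
    have "\<bar>T (apply_bcontfun f) b - T (apply_bcontfun g) b\<bar> \<le> \<beta> * dist f g"
      unfolding T_def
      using q[of f Do_nothing g] q[of g Do_nothing f] q[of f Reset g] q[of g Reset f]
      by (auto simp: dist_commute)
    then show "dist (apply_bcontfun (Bcontfun (T (apply_bcontfun f))) b)
        (apply_bcontfun (Bcontfun (T (apply_bcontfun g))) b) \<le> \<beta> * dist f g"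
      by (simp add: Bcontfun_inverse T_bcontfun dist_real_def)
  qed
  obtain f where "Bcontfun (T (apply_bcontfun f)) = f"
    using banach_fix_type[OF \<beta>, of "\<lambda>f. Bcontfun (T (apply_bcontfun f))"] contract by blast
  then have fix_T: "apply_bcontfun f = T (apply_bcontfun f)"
    by (metis Bcontfun_inverse T_bcontfun)
  \<comment> \<open>On [0,1] the clamp is the identity, so the fixed point of \<open>T\<close>
    satisfies the Bellman equation there.\<close>
  have "apply_bcontfun f b = max (action_value \<beta> A \<mu> f Do_nothing b) (action_value \<beta> A \<mu> f Reset b)"
    if "b \<in> {0..1}" for b
    using fun_cong[OF fix_T, of b] by (simp add: T_def c_id[OF that])
  moreover have "bounded (apply_bcontfun f ` {0..1})"
    unfolding bounded_iff using bound by auto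
  ultimately have "bounded_bellman_solution \<beta> A \<mu> (apply_bcontfun f)"
    unfolding bounded_bellman_solution_def using int by auto
  then show ?thesis
    by blast
qed

text \<open>Justifies the definite description: a restricted solution exists, and extensional
  functions that agree on [0,1] are equal.\<close>

lemma bounded_bellman_solution_subsidy_value:
  assumes A: "valid_adr A" and \<beta>: "0 \<le> \<beta>" "\<beta> < 1"
  shows "bounded_bellman_solution \<beta> A \<mu> (subsidy_value \<beta> A \<mu>)"
proof -
  obtain V where V: "bounded_bellman_solution \<beta> A \<mu> V"
    using ex_bellman_solution[OF assms] by blast
  let ?P = "\<lambda>V. V \<in> extensional {0..1} \<and> bounded_bellman_solution \<beta> A \<mu> V"
  have "?P (restrict V {0..1})"
    using bounded_bellman_solution_cong[OF A _ V, of "restrict V {0..1}"] by simp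
  moreover have "U = W" if "?P U" "?P W" for U W
    using that bellman_solution_unique[OF A \<beta>]
    by (intro extensionalityI[of U "{0..1}" W]) auto
  ultimately have "\<exists>!V. ?P V"
    by (intro ex1I[of ?P "restrict V {0..1}"])
  from theI'[OF this] show ?thesis
    by (simp add: subsidy_value_def)
qed

section \<open>Indexability\<close>

lemma optimal_action_Do_nothing_iff:
  "optimal_action \<beta> A \<mu> Do_nothing b \<longleftrightarrow>
    action_value \<beta> A \<mu> (subsidy_value \<beta> A \<mu>) Reset b \<le>
    action_value \<beta> A \<mu> (subsidy_value \<beta> A \<mu>) Do_nothing b"
  by (simp add: optimal_action_def) linarith

text \<open>Doing nothing is optimal exactly where this advantage is nonnegative, so its
  monotonicity gives the inclusion of passive sets.\<close>

lemma passive_advantage_mono: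
  assumes A: "valid_adr A" and \<beta>: "0 \<le> \<beta>" "\<beta> < 1" and "\<mu> \<le> \<zeta>" and b: "b \<in> {0..1}"
    and V: "bounded_bellman_solution \<beta> A \<mu> V" and U: "bounded_bellman_solution \<beta> A \<zeta> U"
  shows "action_value \<beta> A \<mu> V Do_nothing b - action_value \<beta> A \<mu> V Reset b \<le>
    action_value \<beta> A \<zeta> U Do_nothing b - action_value \<beta> A \<zeta> U Reset b"
proof -
  define K where "K = \<beta> * (U (1 - fail_prob A) - V (1 - fail_prob A))"
  have reset: "action_value \<beta> A \<zeta> U Reset y = action_value \<beta> A \<mu> V Reset y + K" for y
    by (simp add: action_value_def expected_next_Reset[OF A] K_def algebra_simps)
  have "1 - fail_prob A \<in> {0..1}"
    using A by (simp add: valid_adr_def)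
  from bellman_solution_diff_le[OF A \<beta> this U V]
  have "K \<le> \<beta> * ((\<zeta> - \<mu>) / (1 - \<beta>))"
    unfolding K_def using \<open>\<mu> \<le> \<zeta>\<close> \<beta>(1) by (intro mult_left_mono) auto
  then have "(1 - \<beta>) * K \<le> \<beta> * (\<zeta> - \<mu>)"
    using \<beta>(2) by (simp add: field_simps)
  also have "\<dots> \<le> \<zeta> - \<mu>"
    using \<beta> \<open>\<mu> \<le> \<zeta>\<close> by (simp add: mult_left_le_one_le)
  finally have K: "(1 - \<beta>) * K \<le> \<zeta> - \<mu>" .
  \<comment> \<open>The lower bound \<open>K\<close> on \<open>U - V\<close> is proved as an upper
    bound on \<open>V - U\<close>, to fit \<open>le_by_contraction\<close>.\<close>
  have "V y - U y \<le> - K" if "y \<in> {0..1}" for y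
  proof (rule le_by_contraction[where f = "\<lambda>b. V b - U b", OF _ \<beta>(2) that])
    fix m y :: real
    assume "- K \<le> m" "\<And>z. z \<in> {0..1} \<Longrightarrow> V z - U z \<le> m" and y: "y \<in> {0..1}"
    then have "V z \<le> U z + m" if "z \<in> {0..1}" for z
      using that by (simp add: algebra_simps)
    from bellman_solution_action_value_le(1)[OF A \<beta>(1) y V U this]
    have "V y - U y \<le> max ((\<mu> - \<zeta>) + \<beta> * m) (- K)"
      using bellman_solution_eq[OF V y] bellman_solution_eq[OF U y] reset[of y] by linarith
    \<comment> \<open>This settles the \<open>Reset\<close> branch \<open>- K\<close> of the
      maximum; the other branch reduces to
      \<open>(1 - \<beta>) * K \<le> \<zeta> - \<mu>\<close>.\<close>
    moreover have "0 \<le> \<beta> * (m + K)"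
      using \<open>- K \<le> m\<close> \<beta>(1) by simp
    ultimately show "V y - U y \<le> - K + \<beta> * (m - - K)"
      using K by (auto simp: algebra_simps)
  qed (rule bdd_above_diff_bellman_solutions[OF V U])
  then have "V y \<le> U y + - K" if "y \<in> {0..1}" for y
    using that by fastforce
  \<comment> \<open>With gap \<open>- K\<close>, doing nothing gains at least
    \<open>\<zeta> - \<mu> + \<beta> * K\<close> while resetting gains exactly \<open>K\<close>; the
    bound on \<open>K\<close> compares the two.\<close>
  from bellman_solution_action_value_le(1)[OF A \<beta>(1) b V U this] K show ?thesis
    unfolding reset by (simp add: algebra_simps)
qed

theorem theorem2:
  fixes P :: "('m::finite) repair_problem"
  assumes "valid_repair_problem P"
  shows "indexable P"
  unfolding indexable_def
proof (intro allI impI subsetI, elim conjE)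
  fix i \<mu> \<zeta> b
  let ?A = "adr_of P i" and ?\<beta> = "discount P"
  assume "i < n_adrs P" "\<mu> \<le> \<zeta>" and b: "b \<in> passive_set ?\<beta> ?A \<mu>"
  with assms have A: "valid_adr ?A" and \<beta>: "0 \<le> ?\<beta>" "?\<beta> < 1"
    by (auto simp: valid_repair_problem_def)
  have "b \<in> {0..1}"
    using b by (simp add: passive_set_def)
  note sol = bounded_bellman_solution_subsidy_value[OF A \<beta>]
  from passive_advantage_mono[OF A \<beta> \<open>\<mu> \<le> \<zeta>\<close> \<open>b \<in> {0..1}\<close> sol sol] b
  show "b \<in> passive_set ?\<beta> ?A \<zeta>"
    by (simp add: passive_set_def optimal_action_Do_nothing_iff)
qed

end
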